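(* For all integers $r\ge 3$ and $k\ge 3$ we have $f(r,k)=\infty$.
   Context: A permutation is any finite sequence of distinct integers. Two permutations $(x_1,\dots,x_k)$ and $(y_1,\dots,y_k)$ of the same length are similar if $x_i<x_j$ if and only if $y_i<y_j$ for all $1\le i<j\le k$. For an integer $r\ge 2$, a collection of $r$ pairwise disjoint (occupying pairwise disjoint sets of positions), pairwise similar subsequences of a permutation $\pi$, each of length $k$, forms tight $r$-twins of length $k$ in $\pi$ if the union of the positions they occupy is a segment of consecutive positions of $\pi$ (of length $rk$). For integers $r,k\ge2$, $f(r,k)$ is the minimum $n$ such that every permutation of length $n$ contains tight $r$-twins of length exactly $k$; if no such $n$ exists, $f(r,k)=\infty$. *)

theory Defs
  imports Main "HOL-Library.Extended_Nat" "HOL-Library.Disjoint_Sets"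
begin

text \<open>
  A permutation is a finite sequence of distinct integers, i.e. an \<^typ>\<open>int list\<close> satisfying
  \<^const>\<open>distinct\<close>. Positions are counted from 0.
\<close>

definition similar :: "int list \<Rightarrow> int list \<Rightarrow> bool" where
  "similar xs ys \<longleftrightarrow> length xs = length ys \<and>
     (\<forall>i j. i < j \<and> j < length xs \<longrightarrow> (xs ! i < xs ! j \<longleftrightarrow> ys ! i < ys ! j))"

text \<open>
  A subsequence of \<open>xs\<close> is given by the set \<open>I\<close> of positions it occupies; the subsequence
  itself is \<open>nths xs I\<close>. A collection of \<open>r\<close> subsequences is thus a set of \<open>r\<close> position sets.
\<close>

definition tight_twins :: "nat \<Rightarrow> nat \<Rightarrow> int list \<Rightarrow> nat set set \<Rightarrow> bool" where
  "tight_twins r k xs \<I> \<longleftrightarrow>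
     finite \<I> \<and> card \<I> = r \<and>
     (\<forall>I\<in>\<I>. I \<subseteq> {..<length xs} \<and> card I = k) \<and>
     disjoint \<I> \<and>
     (\<forall>I\<in>\<I>. \<forall>J\<in>\<I>. similar (nths xs I) (nths xs J)) \<and>
     (\<exists>a. \<Union>\<I> = {a..<a + r * k})"

definition contains_tight_twins :: "nat \<Rightarrow> nat \<Rightarrow> int list \<Rightarrow> bool" where
  "contains_tight_twins r k xs \<longleftrightarrow> (\<exists>\<I>. tight_twins r k xs \<I>)"

text \<open>
  In \<^typ>\<open>enat\<close>, the infimum of a nonempty set is its minimum and the infimum of the empty set
  is \<open>\<infinity>\<close>.
\<close>

definition f_tight :: "nat \<Rightarrow> nat \<Rightarrow> enat" where
  "f_tight r k = Inf {enat n | n.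
     \<forall>xs :: int list. distinct xs \<and> length xs = n \<longrightarrow> contains_tight_twins r k xs}"

end

theory Submission imports Defs
begin

text \<open>
  Let \<open>P = r * (k - 1)\<close>. The permutations without twins consist of consecutive increasing layers,
  each lying in value below all earlier ones; the lengths of the layers alternate between \<open>1\<close> (the
  multiples of \<open>P\<close>) and \<open>P - 1\<close> (the positions between two multiples). The pattern of a subsequence
  then records exactly which of its entries share a layer.

  Suppose that \<open>r\<close> twins of length \<open>k\<close> fill a window of \<open>r * k = P + r \<le> 2 * P\<close> positions. The window
  contains one or two multiples of \<open>P\<close>; let \<open>z\<close> be the first. In its twin, \<open>z\<close> shares its layer with no
  other entry. Hence this twin meets three layers, or \<open>z\<close> is its first entry and all others share a
  layer, or \<open>z\<close> is its last entry and all others share a layer. As the twins are similar, all of them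
  have the shape of this one.

  \<^item> Three layers (\<open>not_all_three_layers\<close>). If \<open>z\<close> is the only multiple of \<open>P\<close>, a twin avoiding \<open>z\<close>
    meets only the two long layers next to \<open>z\<close>. If \<open>z + P\<close> is in the window as well, only \<open>r - 1\<close>
    positions of the window lie outside \<open>{z..z + P}\<close>, so some twin lies inside and uses both \<open>z\<close> and
    \<open>z + P\<close>. The other \<open>r - 1\<close> twins can use only one layer inside, so each of them needs two of
    these \<open>r - 1\<close> positions outside.

  \<^item> Lone first entry (\<open>not_all_lone_first\<close>). In each twin the \<open>k - 1 \<ge> 2\<close> other entries lie in one
    layer, which is therefore long. It comes after the layer of the lone entry, so it is the layer \<open>B\<close>
    right after \<open>z\<close> or lies beyond \<open>z + P\<close>. Together these entries number \<open>P\<close>, one too many for \<open>B\<close>, so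
    \<open>m \<ge> 1\<close> twins have them beyond \<open>z + P\<close>, and the window contains all \<open>P\<close> positions of
    \<open>B \<union> {z + P}\<close>. Such a position is the lone entry of one of the \<open>m\<close> twins or a
    non-lone entry of one of the others, so \<open>r * (k - 1) \<le> m + (r - m) * (k - 1)\<close>. This is false for
    \<open>k \<ge> 3\<close>. The count is the lemma \<open>lone_element_count\<close>.

  \<^item> Lone last entry (\<open>not_all_lone_last\<close>). This is the mirror image, with the last multiple of \<open>P\<close> in
    the window in place of \<open>z\<close>.
\<close>

section \<open>The layered permutation\<close>

text \<open>
  Layers are numbered from left to right. An even number means a one-element layer, at a multiple of
  \<open>P\<close>; an odd number means a long layer.
\<close>

definition layer :: "nat \<Rightarrow> nat \<Rightarrow> nat" where
  "layer P i = 2 * (i div P) + (if P dvd i then 0 else 1)"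

text \<open>
  The layers between two multiples of \<open>P\<close> get the residues \<open>1, \<dots>, P - 1\<close>, shifted down by \<open>P\<close> from one to
  the next. A multiple of \<open>P\<close> gets the one value left free between its neighbouring long layers, that of
  a residue \<open>P\<close>.
\<close>

definition layered_value :: "nat \<Rightarrow> nat \<Rightarrow> int" where
  "layered_value P i = int (if P dvd i then P else i mod P) - int P * int (i div P)"

lemma even_layer_iff: "even (layer P i) \<longleftrightarrow> P dvd i"
  by (simp add: layer_def)

lemma layer_mono:
  assumes "i \<le> j"
  shows "layer P i \<le> layer P j"
proof (cases "i div P = j div P")
  case True
  have "P dvd i" if "P dvd j"
  proof -
    have "j = P * (i div P)" using that True by simp
    then have "i = P * (i div P)" using assms times_div_less_eq_dividend[of P i] by linarith
    then show "P dvd i" by (metis dvd_triv_left)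
  qed
  then show ?thesis using True by (auto simp: layer_def)
next
  case False
  then have "i div P < j div P" using assms div_le_mono le_neq_implies_less by blast
  then show ?thesis by (auto simp: layer_def)
qed

lemma layer_add_period: "P > 0 \<Longrightarrow> layer P (i + P) = layer P i + 2"
  by (simp add: layer_def)

lemma layer_eq_singleton_iff:
  assumes "P dvd z"
  shows "layer P i = layer P z \<longleftrightarrow> i = z"
proof
  assume eq: "layer P i = layer P z"
  with assms have "P dvd i" by (metis even_layer_iff)
  then have "i div P = z div P" using eq assms by (simp add: layer_def)
  then show "i = z" using \<open>P dvd i\<close> assms by (metis dvd_div_mult_self)
qed simp

lemma layer_less_singleton_iff:
  assumes "P dvd z"
  shows "layer P i < layer P z \<longleftrightarrow> i < z" and "layer P z < layer P i \<longleftrightarrow> z < i"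
  using layer_mono[of i z P] layer_mono[of z i P] layer_eq_singleton_iff[OF assms, of i]
  by linarith+

lemma layer_eq_interior_iff:
  assumes "P dvd z" "P > 0"
  shows "layer P i = layer P z + 1 \<longleftrightarrow> z < i \<and> i < z + P"
proof -
  have "P dvd z + P" using assms by simp
  then show ?thesis
    using layer_less_singleton_iff(2)[OF assms(1), of i] layer_less_singleton_iff(1)[of P "z + P" i]
      layer_add_period[OF assms(2), of z] by auto
qed

lemma layered_value_less:
  assumes "i < j" "P > 0"
  shows "layer P i = layer P j \<Longrightarrow> layered_value P i < layered_value P j"
    and "layer P i \<noteq> layer P j \<Longrightarrow> layered_value P j < layered_value P i"
proof -
  have split: "i = P * (i div P) + i mod P" "j = P * (j div P) + j mod P" by simp_all
  have same: "\<not> P dvd j \<and> i mod P < j mod P" if "i div P = j div P"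
    using that assms(1) split by (metis dvd_imp_mod_0 nat_add_left_cancel_less not_less_zero)
  show "layered_value P i < layered_value P j" if "layer P i = layer P j"
  proof -
    have "i div P = j div P \<and> (P dvd i \<longleftrightarrow> P dvd j)"
      using that even_layer_iff[of P i] even_layer_iff[of P j] by (auto simp: layer_def)
    then show ?thesis using same by (auto simp: layered_value_def)
  qed
  show "layered_value P j < layered_value P i" if "layer P i \<noteq> layer P j"
  proof (cases "i div P = j div P")
    case True
    then have "P dvd i" using that same by (auto simp: layer_def split: if_splits)
    then show ?thesis using True same assms(2) by (simp add: layered_value_def)
  next
    case False
    then have "i div P < j div P" using assms(1) div_le_mono le_neq_implies_less less_imp_le by metis
    then have "int P * (int (i div P) + 1) \<le> int P * int (j div P)"
      by (intro mult_left_mono) auto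
    then have 1: "int P * int (i div P) + int P \<le> int P * int (j div P)"
      by (simp add: algebra_simps)
    have "layered_value P j \<le> int P - int P * int (j div P)"
      using assms(2) by (auto simp: layered_value_def intro: less_imp_le)
    also have "\<dots> < 1 - int P * int (i div P)" using 1 by linarith
    also have "\<dots> \<le> layered_value P i"
      using assms(2) by (auto simp: layered_value_def dvd_eq_mod_eq_0)
    finally show ?thesis .
  qed
qed

lemma inj_layered_value:
  assumes "P > 0"
  shows "inj (layered_value P)"
proof (rule linorder_injI)
  fix i j :: nat
  assume "i < j"
  then show "layered_value P i \<noteq> layered_value P j"
    using layered_value_less[OF _ assms] by (metis less_irrefl)
qed

section \<open>Counting positions in twins with one lone entry\<close>

lemma nths_conv_sorted_list_of_set:
  assumes "I \<subseteq> {..<length xs}"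
  shows "nths xs I = map (nth xs) (sorted_list_of_set I)"
proof -
  have "zip xs [0..<length xs] = map (\<lambda>i. (xs ! i, i)) [0..<length xs]"
    by (rule nth_equalityI) auto
  moreover have "filter (\<lambda>i. i \<in> I) [0..<length xs] = sorted_list_of_set I"
  proof (rule sorted_distinct_set_unique)
    show "set (filter (\<lambda>i. i \<in> I) [0..<length xs]) = set (sorted_list_of_set I)"
      using assms finite_subset[OF assms] by auto
  qed (auto intro: sorted_wrt_filter)
  ultimately show ?thesis by (simp add: nths_def filter_map comp_def)
qed

text \<open>
  The double count behind both lone-entry cases, free of any order so that it serves the case of a
  lone first entry and its mirror image alike. \<open>B\<close> is a long layer beside a multiple of \<open>P\<close>, \<open>K\<close> is \<open>B\<close>
  together with the next multiple of \<open>P\<close>, and \<open>F\<close> is the part of the window beyond. Too small for all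
  the remainders \<open>I - {s I}\<close>, \<open>B\<close> forces \<open>m \<ge> 1\<close> of them into \<open>F\<close>; but then too few entries are left to
  cover \<open>K\<close>, as a twin with remainder in \<open>F\<close> contributes at most its lone element there.
\<close>

lemma lone_element_count:
  fixes \<I> :: "'a set set" and s :: "'a set \<Rightarrow> 'a"
  assumes fin: "finite \<I>" and cardI: "card \<I> = r" and disj: "disjoint \<I>" and k: "k \<ge> 3"
    and mem: "\<And>I. I \<in> \<I> \<Longrightarrow> finite I \<and> card I = k \<and> s I \<in> I"
    and rest: "\<And>I. I \<in> \<I> \<Longrightarrow> I - {s I} \<subseteq> B \<or> I - {s I} \<subseteq> F"
    and lone: "\<And>I. I \<in> \<I> \<Longrightarrow> s I \<in> K \<Longrightarrow> I - {s I} \<subseteq> F"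
    and B: "finite B" "card B < r * (k - 1)"
    and K: "F \<noteq> {} \<Longrightarrow> K \<subseteq> \<Union>\<I> \<and> r * (k - 1) \<le> card K" "K \<inter> F = {}"
  shows False
proof -
  define R where "R I = I - {s I}" for I
  have R: "finite (R I) \<and> card (R I) = k - 1" if "I \<in> \<I>" for I
    using mem[OF that] by (simp add: R_def)
  have card_R: "card (\<Union>(R ` S)) = (k - 1) * card S" if "S \<subseteq> \<I>" for S
  proof -
    have "card (\<Union>(R ` S)) = (\<Sum>I\<in>S. card (R I))"
    proof (rule card_UN_disjoint)
      show "\<forall>I\<in>S. \<forall>J\<in>S. I \<noteq> J \<longrightarrow> R I \<inter> R J = {}"
        using disj that unfolding R_def disjoint_def by blast
    qed (use fin finite_subset that R in auto)
    also have "\<dots> = (\<Sum>I\<in>S. k - 1)" using R that by (intro sum.cong) auto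
    finally show ?thesis by simp
  qed
  define J where "J = {I \<in> \<I>. R I \<subseteq> F}"
  have J: "J \<subseteq> \<I>" by (auto simp: J_def)
  show False
  proof (cases "J = {}")
    case True
    then have "\<Union>(R ` \<I>) \<subseteq> B" using rest by (auto simp: J_def R_def)
    then have "card (\<Union>(R ` \<I>)) \<le> card B" using B(1) card_mono by blast
    then show False using card_R[of \<I>] cardI B(2) by (simp add: mult.commute)
  next
    case False
    then obtain I where "I \<in> \<I>" "R I \<subseteq> F" by (auto simp: J_def)
    moreover have "R I \<noteq> {}" using R[OF \<open>I \<in> \<I>\<close>] k by auto
    ultimately have "F \<noteq> {}" by auto
    note K1 = K(1)[OF this]
    have "K \<subseteq> s ` J \<union> \<Union>(R ` (\<I> - J))"
    proof
      fix x assume x: "x \<in> K"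
      then obtain I where I: "I \<in> \<I>" "x \<in> I" using K1 by auto
      show "x \<in> s ` J \<union> \<Union>(R ` (\<I> - J))"
      proof (cases "x = s I")
        case True
        then show ?thesis using lone[OF I(1)] x I(1) by (auto simp: J_def R_def)
      next
        case False
        then have "x \<in> R I" using I by (simp add: R_def)
        moreover have "I \<notin> J" using \<open>x \<in> R I\<close> x K(2) by (auto simp: J_def)
        ultimately show ?thesis using I by auto
      qed
    qed
    moreover have "finite J" using J fin finite_subset by blast
    moreover have "finite (\<Union>(R ` (\<I> - J)))" using fin R by auto
    ultimately have "card K \<le> card (s ` J \<union> \<Union>(R ` (\<I> - J)))"
      by (intro card_mono) auto
    also have "\<dots> \<le> card (s ` J) + card (\<Union>(R ` (\<I> - J)))" by (rule card_Un_le)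
    also have "\<dots> \<le> card J + (k - 1) * card (\<I> - J)"
      using card_image_le[OF \<open>finite J\<close>] card_R[of "\<I> - J"] by (simp add: add_mono)
    finally have "r * (k - 1) \<le> card J + (k - 1) * card (\<I> - J)" using K1 by linarith
    moreover have "card (\<I> - J) + card J = r"
      using card_Diff_subset[OF \<open>finite J\<close> J] card_mono[OF fin J] cardI by simp
    then have "r * (k - 1) = (k - 1) * card (\<I> - J) + (k - 1) * card J"
      by (metis add_mult_distrib2 mult.commute)
    ultimately have "(k - 1) * card J \<le> card J" by linarith
    moreover have "card J > 0" using False \<open>finite J\<close> by (simp add: card_gt_0_iff)
    moreover have "2 * card J \<le> (k - 1) * card J" using k by (intro mult_right_mono) auto
    ultimately show False by linarith
  qed
qed

section \<open>Twins that agree in their layer structure\<close>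

text \<open>
  The twins without the similarity condition: they are merely required to fill a window. The
  similarity enters below, in the form that all twins have the same layer structure.
\<close>

locale layered_twins =
  fixes r k a P :: nat and \<I> :: "nat set set"
  assumes r: "r \<ge> 2" and k: "k \<ge> 3" and P_def: "P = r * (k - 1)"
    and finite_twins: "finite \<I>" and card_twins: "card \<I> = r" and disjoint_twins: "disjoint \<I>"
    and card_twin: "I \<in> \<I> \<Longrightarrow> card I = k"
    and Union_twins: "\<Union>\<I> = {a..<a + r * k}"
begin

lemma window_length: "r * k = P + r"
  using k by (cases k) (auto simp: P_def)

lemma P_pos: "P > 0"
  using r k by (simp add: P_def)

lemma window_le: "r * k \<le> 2 * P"
proof -
  have "r * k \<le> r * (2 * (k - 1))" using k by (intro mult_left_mono) auto
  then show ?thesis by (simp add: P_def)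
qed

lemma finite_twin: "I \<in> \<I> \<Longrightarrow> finite I"
  using card_twin[of I] k by (intro card_ge_0_finite) simp

text \<open>
  The first multiple of \<open>P\<close> in the window. Adding \<open>P - 1\<close> before the division rounds up.
\<close>

definition z where "z = P * ((a + P - 1) div P)"

lemma z: "P dvd z" "a \<le> z" "z < a + P"
proof -
  show "P dvd z" by (simp add: z_def)
  have "a + P - 1 = z + (a + P - 1) mod P" by (simp add: z_def)
  moreover have "(a + P - 1) mod P < P" using P_pos by simp
  ultimately show "a \<le> z" "z < a + P" by linarith+
qed

lemma z_in: "z \<in> \<Union>\<I>"
  using z window_length unfolding Union_twins by simp

lemma multiple_in_window:
  assumes "P dvd x" "x \<in> \<Union>\<I>"
  shows "x = z \<or> x = z + P"
proof -
  have x: "a \<le> x" "x < a + 2 * P" using assms(2) window_le unfolding Union_twins by auto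
  obtain p q where pq: "x = P * p" "z = P * q" using assms(1) z(1) by (meson dvd_def)
  have "P * q < P * (p + 1)" using x(1) z(3) pq by simp
  then have "q \<le> p" by (metis Suc_eq_plus1 less_Suc_eq_le mult_less_cancel1)
  moreover have "P * p < P * (q + 2)" using x(2) z(2) pq by (simp add: algebra_simps)
  then have "p < q + 2" by (metis mult_less_cancel1)
  ultimately have "p = q \<or> p = q + 1" by linarith
  then show ?thesis using pq by auto
qed

lemma layer_lower:
  assumes "x \<in> \<Union>\<I>"
  shows "layer P z \<le> layer P x + 1"
proof -
  have "z < x + P" using assms z unfolding Union_twins by simp
  then have "layer P z < layer P (x + P)" using layer_less_singleton_iff(2) z(1) by blast
  then show ?thesis using layer_add_period[OF P_pos, of x] by linarith
qed

text \<open>The last multiple of \<open>P\<close> in the window.\<close>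

definition y where "y = (if z + P \<in> \<Union>\<I> then z + P else z)"

lemma y: "P dvd y" "y \<in> \<Union>\<I>"
  using z(1) z_in by (auto simp: y_def)

lemma layer_upper:
  assumes "x \<in> \<Union>\<I>"
  shows "layer P x \<le> layer P y + 1"
proof -
  have "x < y + P" using assms z window_le unfolding Union_twins y_def by auto
  moreover have "P dvd y + P" using y(1) by simp
  ultimately have "layer P x < layer P (y + P)" using layer_less_singleton_iff(1) by blast
  then show ?thesis using layer_add_period[OF P_pos, of y] by linarith
qed

lemma multiples_in_distinct_layers:
  assumes "u \<noteq> v" "layer P u = layer P v"
  shows "odd (layer P u)"
  using assms layer_eq_singleton_iff even_layer_iff by metis

text \<open>
  As \<open>k \<ge> 3\<close>, the remainder of a twin has at least two elements, so it does not fit into a layer of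
  length one.
\<close>

lemma twin_rest_layer_odd:
  assumes "I \<in> \<I>" "s \<in> I" "\<And>x. x \<in> I - {s} \<Longrightarrow> layer P x = c"
  shows "odd c"
proof -
  have "card (I - {s}) \<ge> 2" using card_twin[OF assms(1)] finite_twin[OF assms(1)] assms(2) k by simp
  then obtain T where "T \<subseteq> I - {s}" "card T = 2" by (metis obtain_subset_with_card_n)
  then obtain u v where "u \<in> I - {s}" "v \<in> I - {s}" "u \<noteq> v" by (auto simp: card_2_iff)
  then show ?thesis using assms(3) multiples_in_distinct_layers by metis
qed

lemma card_interior: "card {x. w < x \<and> x < w + P} = P - 1"
proof -
  have "{x. w < x \<and> x < w + P} = {w<..<w + P}" by auto
  then show ?thesis by simp
qed

text \<open>
  The layers of the window start at the one just before \<open>z\<close>. A layer later than that of some entry is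
  thus not the one before \<open>z\<close>; if it is also long, it is the one after \<open>z\<close> or lies beyond \<open>z + P\<close>.
\<close>

lemma not_all_lone_first:
  assumes "\<And>I. I \<in> \<I> \<Longrightarrow> s I \<in> I"
    and "\<And>I x. I \<in> \<I> \<Longrightarrow> x \<in> I - {s I} \<Longrightarrow> layer P x = c I"
    and "\<And>I. I \<in> \<I> \<Longrightarrow> layer P (s I) < c I"
  shows False
proof (rule lone_element_count[of \<I> r k s "{x. z < x \<and> x < z + P}" "{x \<in> \<Union>\<I>. z + P < x}"
        "{z<..z + P}"])
  have c: "c I = layer P z + 1 \<or> layer P z + 2 < c I" if I: "I \<in> \<I>" for I
  proof -
    have "odd (c I)" using twin_rest_layer_odd assms(1,2) I by blast
    moreover have "even (layer P z)" using z(1) by (simp add: even_layer_iff)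
    moreover have "layer P z \<le> layer P (s I) + 1" using layer_lower assms(1) I by blast
    moreover note assms(3)[OF I]
    ultimately show ?thesis by presburger
  qed
  have B: "x \<in> {x. z < x \<and> x < z + P}" if "layer P x = layer P z + 1" for x
    using that layer_eq_interior_iff[OF z(1) P_pos] by simp
  have zP: "P dvd z + P" using z(1) by simp
  have F: "z + P < x" if "layer P z + 2 < layer P x" for x
    using that layer_less_singleton_iff(2)[OF zP] layer_add_period[OF P_pos, of z] by simp
  show "I - {s I} \<subseteq> {x. z < x \<and> x < z + P} \<or> I - {s I} \<subseteq> {x \<in> \<Union>\<I>. z + P < x}"
    if I: "I \<in> \<I>" for I
    using c[OF I] assms(2)[OF I] B F I by fastforce
  show "I - {s I} \<subseteq> {x \<in> \<Union>\<I>. z + P < x}" if I: "I \<in> \<I>" and s: "s I \<in> {z<..z + P}" for I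
  proof -
    have "layer P z < layer P (s I)" using s layer_less_singleton_iff(2)[OF z(1)] by simp
    then have "layer P z + 2 < c I" using assms(3)[OF I] c[OF I] by linarith
    then show ?thesis using assms(2)[OF I] F I by fastforce
  qed
  show "finite {x. z < x \<and> x < z + P}" by simp
  show "card {x. z < x \<and> x < z + P} < r * (k - 1)"
    using card_interior P_pos by (simp add: P_def)
  show "{z<..z + P} \<subseteq> \<Union>\<I> \<and> r * (k - 1) \<le> card {z<..z + P}"
    if "{x \<in> \<Union>\<I>. z + P < x} \<noteq> {}"
    using that z(2) unfolding Union_twins by (auto simp: P_def)
  show "finite I \<and> card I = k \<and> s I \<in> I" if "I \<in> \<I>" for I
    using that finite_twin card_twin assms(1) by simp
qed (fact finite_twins card_twins disjoint_twins k | auto)+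

text \<open>
  The same argument read from right to left. The sets are described by conditions on \<open>x + P\<close>, since
  \<open>y - P\<close> would be truncated when \<open>y = 0\<close>.
\<close>

lemma not_all_lone_last:
  assumes "\<And>I. I \<in> \<I> \<Longrightarrow> s I \<in> I"
    and "\<And>I x. I \<in> \<I> \<Longrightarrow> x \<in> I - {s I} \<Longrightarrow> layer P x = c I"
    and "\<And>I. I \<in> \<I> \<Longrightarrow> c I < layer P (s I)"
  shows False
proof (rule lone_element_count[of \<I> r k s "{x. x < y \<and> y < x + P}" "{x \<in> \<Union>\<I>. x + P < y}"
        "{x. x < y \<and> y \<le> x + P}"])
  have c: "c I + 1 = layer P y \<or> c I + 2 < layer P y" if I: "I \<in> \<I>" for I
  proof -
    have "odd (c I)" using twin_rest_layer_odd assms(1,2) I by blast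
    moreover have "even (layer P y)" using y(1) by (simp add: even_layer_iff)
    moreover have "layer P (s I) \<le> layer P y + 1" using layer_upper assms(1) I by blast
    moreover note assms(3)[OF I]
    ultimately show ?thesis by presburger
  qed
  have B: "x \<in> {x. x < y \<and> y < x + P}" if "layer P x + 1 = layer P y" for x
    using that layer_less_singleton_iff(1)[OF y(1), of x]
      layer_less_singleton_iff(2)[OF y(1), of "x + P"] layer_add_period[OF P_pos, of x] by simp
  have F: "x + P < y" if "layer P x + 2 < layer P y" for x
    using that layer_less_singleton_iff(1)[OF y(1), of "x + P"] layer_add_period[OF P_pos, of x] by simp
  show "I - {s I} \<subseteq> {x. x < y \<and> y < x + P} \<or> I - {s I} \<subseteq> {x \<in> \<Union>\<I>. x + P < y}"
    if I: "I \<in> \<I>" for I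
    using c[OF I] assms(2)[OF I] B F I by fastforce
  show "I - {s I} \<subseteq> {x \<in> \<Union>\<I>. x + P < y}"
    if I: "I \<in> \<I>" and s: "s I \<in> {x. x < y \<and> y \<le> x + P}" for I
  proof -
    have "layer P (s I) < layer P y" using s layer_less_singleton_iff(1)[OF y(1)] by simp
    then have "c I + 2 < layer P y" using assms(3)[OF I] c[OF I] by linarith
    then show ?thesis using assms(2)[OF I] F I by fastforce
  qed
  show "finite {x. x < y \<and> y < x + P}" by simp
  have "{x. x < y \<and> y < x + P} \<subseteq> {y - (P - 1)..<y}" by auto
  then have "card {x. x < y \<and> y < x + P} \<le> card {y - (P - 1)..<y}" by (intro card_mono) auto
  also have "\<dots> < P" using P_pos by simp
  finally show "card {x. x < y \<and> y < x + P} < r * (k - 1)" by (simp add: P_def)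
  show "{x. x < y \<and> y \<le> x + P} \<subseteq> \<Union>\<I> \<and> r * (k - 1) \<le> card {x. x < y \<and> y \<le> x + P}"
    if ne: "{x \<in> \<Union>\<I>. x + P < y} \<noteq> {}"
  proof -
    have y_bounds: "a + P < y" "y < a + r * k" using ne y(2) unfolding Union_twins by auto
    have "{x. x < y \<and> y \<le> x + P} = {y - P..<y}" using y_bounds(1) by auto
    then have "card {x. x < y \<and> y \<le> x + P} = P" using y_bounds(1) by simp
    moreover have "{x. x < y \<and> y \<le> x + P} \<subseteq> \<Union>\<I>"
      unfolding Union_twins using y_bounds by (simp add: subset_iff)
    ultimately show ?thesis by (simp add: P_def)
  qed
  show "finite I \<and> card I = k \<and> s I \<in> I" if "I \<in> \<I>" for I
    using that finite_twin card_twin assms(1) by simp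
qed (fact finite_twins card_twins disjoint_twins k | auto)+

text \<open>
  Both the number of positions outside \<open>{z..z + P}\<close> and the number of twins other than the one
  using \<open>z\<close> and \<open>z + P\<close> equal \<open>r - 1\<close>, and these twins need two outside positions each.
\<close>

lemma not_all_three_layers:
  assumes three: "\<And>I. I \<in> \<I> \<Longrightarrow> \<exists>p\<in>I. \<exists>q\<in>I. \<exists>t\<in>I. layer P p < layer P q \<and> layer P q < layer P t"
  shows False
proof -
  have disj: "I = J" if "I \<in> \<I>" "J \<in> \<I>" "x \<in> I" "x \<in> J" for I J x
    using disjoint_twins that unfolding disjoint_def by blast
  obtain I0 where I0: "I0 \<in> \<I>" "z \<in> I0" using z_in by blast
  \<comment> \<open>Without \<open>z + P\<close> the window has only three layers, and those next to \<open>z\<close> are the only ones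
    available to a twin that avoids \<open>z\<close>.\<close>
  have zP_in: "z + P \<in> \<Union>\<I>"
  proof (rule ccontr)
    assume n: "z + P \<notin> \<Union>\<I>"
    have "\<I> \<noteq> {I0}" using card_twins r by auto
    then obtain J where J: "J \<in> \<I>" "J \<noteq> I0" using I0 by auto
    have "odd (layer P x) \<and> layer P z \<le> layer P x + 1 \<and> layer P x \<le> layer P z + 1" if "x \<in> J" for x
    proof -
      have x: "x \<in> \<Union>\<I>" using that J by blast
      have "x \<noteq> z" using disj[OF J(1) I0(1)] that I0(2) J(2) by auto
      then have "\<not> P dvd x" using multiple_in_window[OF _ x] n x by auto
      then show ?thesis using layer_lower[OF x] layer_upper[OF x] n by (simp add: even_layer_iff y_def)
    qed
    then have only: "layer P x + 1 = layer P z \<or> layer P x = layer P z + 1" if "x \<in> J" for x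
      using that z(1) even_layer_iff[of P z] by (metis (no_types, lifting) Suc_eq_plus1 even_Suc le_SucE le_antisym)
    obtain p q t where "p \<in> J" "q \<in> J" "t \<in> J" "layer P p < layer P q" "layer P q < layer P t"
      using three[OF J(1)] by blast
    then show False using only[of p] only[of q] only[of t] by linarith
  qed
  define Out where "Out = \<Union>\<I> - {z..z + P}"
  have fin: "finite Out" by (simp add: Out_def Union_twins)
  have card_Out: "card Out + 1 = r"
  proof -
    have "{z..z + P} \<subseteq> \<Union>\<I>" using z(2) zP_in unfolding Union_twins by auto
    then have "card Out = r * k - (P + 1)"
      unfolding Out_def by (subst card_Diff_subset) (auto simp: Union_twins)
    then show ?thesis using window_length r by simp
  qed
  have sum_Out: "(\<Sum>I\<in>S. card (I \<inter> Out)) \<le> card Out" if S: "S \<subseteq> \<I>" for S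
  proof -
    have "(\<Sum>I\<in>S. card (I \<inter> Out)) = card (\<Union>I\<in>S. I \<inter> Out)"
    proof (rule card_UN_disjoint[symmetric])
      show "\<forall>I\<in>S. \<forall>J\<in>S. I \<noteq> J \<longrightarrow> (I \<inter> Out) \<inter> (J \<inter> Out) = {}" using disj S by blast
    qed (use S finite_twins finite_subset fin in auto)
    also have "\<dots> \<le> card Out" using fin by (intro card_mono) auto
    finally show ?thesis .
  qed
  have mid: "layer P x = layer P z + 1 \<or> x = z \<or> x = z + P" if "x \<in> {z..z + P}" for x
    using that layer_eq_interior_iff[OF z(1) P_pos, of x] by auto
  have lay: "layer P (z + P) = layer P z + 2" using layer_add_period[OF P_pos] .
  \<comment> \<open>\<open>r\<close> disjoint twins cannot all meet a set of \<open>r - 1\<close> positions.\<close>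
  have "\<exists>I\<in>\<I>. I \<inter> Out = {}"
  proof (rule ccontr)
    assume "\<not> ?thesis"
    then have "I \<inter> Out \<noteq> {}" if "I \<in> \<I>" for I using that by blast
    then have "1 \<le> card (I \<inter> Out)" if "I \<in> \<I>" for I
      using that fin by (metis One_nat_def Suc_leI card_gt_0_iff finite_Int)
    then have "(\<Sum>I\<in>\<I>. 1) \<le> (\<Sum>I\<in>\<I>. card (I \<inter> Out))" by (rule sum_mono)
    then show False using sum_Out[of \<I>] card_Out card_twins by simp
  qed
  then obtain I where I: "I \<in> \<I>" "I \<inter> Out = {}" by blast
  have zI: "z \<in> I" and zPI: "z + P \<in> I"
  proof -
    obtain p q t where *: "p \<in> I" "q \<in> I" "t \<in> I" "layer P p < layer P q" "layer P q < layer P t"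
      using three[OF I(1)] by blast
    have "p \<in> {z..z + P}" "q \<in> {z..z + P}" "t \<in> {z..z + P}" using * I unfolding Out_def by blast+
    then have "p = z" "t = z + P" using mid[of p] mid[of q] mid[of t] * lay by auto
    then show "z \<in> I" "z + P \<in> I" using * by auto
  qed
  \<comment> \<open>Inside \<open>{z..z + P}\<close> only the long layer is left for the other twins, so of three entries in
    different layers at most one is inside.\<close>
  have two: "2 \<le> card (J \<inter> Out)" if J: "J \<in> \<I> - {I}" for J
  proof -
    obtain p q t where *: "p \<in> J" "q \<in> J" "t \<in> J" "layer P p < layer P q" "layer P q < layer P t"
      using three J by blast
    have Out: "x \<in> J \<inter> Out \<or> layer P x = layer P z + 1" if "x \<in> J" for x
      using that mid[of x] disj[of I J] zI zPI I J unfolding Out_def by auto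
    have ne: "p \<noteq> q" "p \<noteq> t" "q \<noteq> t" using * by auto
    have "\<exists>u v. u \<noteq> v \<and> {u, v} \<subseteq> J \<inter> Out"
      using Out[OF *(1)] Out[OF *(2)] Out[OF *(3)] *(4,5) ne
      by (metis empty_subsetI insert_subset less_irrefl less_trans)
    then obtain u v where "u \<noteq> v" "{u, v} \<subseteq> J \<inter> Out" by blast
    then show ?thesis using card_mono[of "J \<inter> Out" "{u, v}"] fin by simp
  qed
  have "2 * card (\<I> - {I}) \<le> (\<Sum>J\<in>\<I> - {I}. card (J \<inter> Out))"
    using sum_mono[of "\<I> - {I}" "\<lambda>_. 2" "\<lambda>J. card (J \<inter> Out)"] two by simp
  also have "\<dots> \<le> card Out" by (rule sum_Out) auto
  finally show False using card_Out card_twins I(1) finite_twins r by simp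
qed

text \<open>
  The shape is read off the twin of \<open>z\<close> and transferred index by index to all others; \<open>e I i\<close> is the
  \<open>i\<close>-th position of the twin \<open>I\<close>.
\<close>

lemma not_same_layer_pattern:
  fixes e :: "nat set \<Rightarrow> nat \<Rightarrow> nat"
  assumes img: "\<And>I. I \<in> \<I> \<Longrightarrow> e I ` {..<k} = I"
    and mono: "\<And>I i j. I \<in> \<I> \<Longrightarrow> i < j \<Longrightarrow> j < k \<Longrightarrow> e I i < e I j"
    and same: "\<And>I J i j. I \<in> \<I> \<Longrightarrow> J \<in> \<I> \<Longrightarrow> i < j \<Longrightarrow> j < k \<Longrightarrow>
      layer P (e I i) = layer P (e I j) \<longleftrightarrow> layer P (e J i) = layer P (e J j)"
  shows False
proof -
  have mem: "e I i \<in> I" if "I \<in> \<I>" "i < k" for I i using img that by blast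
  have le: "layer P (e I i) \<le> layer P (e I j)" if "I \<in> \<I>" "i < j" "j < k" for I i j
    using mono[OF that] layer_mono by simp
  obtain I where I: "I \<in> \<I>" "z \<in> I" using z_in by blast
  then have "z \<in> e I ` {..<k}" using img by simp
  then obtain n where n: "n < k" "e I n = z" by auto
  have lone: "layer P (e I i) \<noteq> layer P (e I n)" if "i < k" "i \<noteq> n" for i
  proof -
    have "e I i \<noteq> e I n" using mono[OF I(1), of i n] mono[OF I(1), of n i] that n by force
    then show ?thesis using layer_eq_singleton_iff[OF z(1)] n by simp
  qed
  \<comment> \<open>Layers are monotone along a twin, so two changes of layer mean three different layers.\<close>
  define chain where "chain J i j l \<longleftrightarrow> i < j \<and> j < l \<and> l < k \<and>
    layer P (e J i) \<noteq> layer P (e J j) \<and> layer P (e J j) \<noteq> layer P (e J l)" for J i j l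
  have no_chain: "\<not> chain I i j l" for i j l
  proof
    assume ch: "chain I i j l"
    show False
    proof (rule not_all_three_layers)
      fix J assume J: "J \<in> \<I>"
      have "chain J i j l" using ch same[OF I(1) J, of i j] same[OF I(1) J, of j l] by (simp add: chain_def)
      then have "layer P (e J i) < layer P (e J j)" "layer P (e J j) < layer P (e J l)"
        "i < k" "j < k" "l < k"
        using le[OF J, of i j] le[OF J, of j l] by (auto simp: chain_def)
      then show "\<exists>p\<in>J. \<exists>q\<in>J. \<exists>t\<in>J. layer P p < layer P q \<and> layer P q < layer P t"
        using mem[OF J] by blast
    qed
  qed
  have "n = 0 \<or> n = k - 1"
  proof (rule ccontr)
    assume "\<not> (n = 0 \<or> n = k - 1)"
    then have "n - 1 < n" "n < n + 1" "n + 1 < k" using n(1) by auto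
    then have "chain I (n - 1) n (n + 1)"
      using lone[of "n - 1"] lone[of "n + 1"] by (auto simp: chain_def)
    then show False using no_chain by blast
  qed
  then show False
  proof
    assume n0: "n = 0"
    have I1: "layer P (e I 1) = layer P (e I i)" if "1 < i" "i < k" for i
      using no_chain[of 0 1 i] lone[of 1] that n0 k by (auto simp: chain_def)
    show False
    proof (rule not_all_lone_first[of "\<lambda>J. e J 0" "\<lambda>J. layer P (e J 1)"])
      fix J x assume J: "J \<in> \<I>" and x: "x \<in> J - {e J 0}"
      then obtain i where i: "i < k" "x = e J i" "i \<noteq> 0" using img[OF J] by auto
      then show "layer P x = layer P (e J 1)"
        using same[OF I(1) J, of 1 i] I1[of i] by (cases "i = 1") auto
    next
      fix J assume J: "J \<in> \<I>"
      show "e J 0 \<in> J" using mem[OF J] k by simp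
      have "layer P (e J 0) \<noteq> layer P (e J 1)"
        using same[OF I(1) J, of 0 1] lone[of 1] n0 k by auto
      then show "layer P (e J 0) < layer P (e J 1)" using le[OF J, of 0 1] k by simp
    qed
  next
    assume nk: "n = k - 1"
    have I1: "layer P (e I i) = layer P (e I (k - 2))" if "i < k - 2" for i
      using no_chain[of i "k - 2" "k - 1"] lone[of "k - 2"] that nk k by (auto simp: chain_def)
    show False
    proof (rule not_all_lone_last[of "\<lambda>J. e J (k - 1)" "\<lambda>J. layer P (e J (k - 2))"])
      fix J x assume J: "J \<in> \<I>" and x: "x \<in> J - {e J (k - 1)}"
      then obtain i where i: "i < k" "x = e J i" "i \<noteq> k - 1" using img[OF J] by auto
      show "layer P x = layer P (e J (k - 2))"
      proof (cases "i = k - 2")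
        case False
        then have "i < k - 2" using i by linarith
        then show ?thesis using same[OF I(1) J, of i "k - 2"] I1[of i] i k by auto
      qed (use i in simp)
    next
      fix J assume J: "J \<in> \<I>"
      show "e J (k - 1) \<in> J" using mem[OF J] k by simp
      have "layer P (e J (k - 2)) \<noteq> layer P (e J (k - 1))"
        using same[OF I(1) J, of "k - 2" "k - 1"] lone[of "k - 2"] nk k by auto
      moreover have "layer P (e J (k - 2)) \<le> layer P (e J (k - 1))"
        by (rule le[OF J]) (use k in auto)
      ultimately show "layer P (e J (k - 2)) < layer P (e J (k - 1))" by simp
    qed
  qed
qed

end

section \<open>Permutations of every length without tight twins\<close>

text \<open>
  Since \<open>layered_value\<close> increases from one position to a later one exactly when both are in the same
  layer, similarity of twins is the agreement of layer structure that has been excluded.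
\<close>

lemma layered_no_tight_twins:
  assumes r: "r \<ge> 2" and k: "k \<ge> 3"
  shows "\<not> contains_tight_twins r k (map (layered_value (r * (k - 1))) [0..<n])"
proof
  define P where "P = r * (k - 1)"
  define xs where "xs = map (layered_value P) [0..<n]"
  assume "contains_tight_twins r k (map (layered_value (r * (k - 1))) [0..<n])"
  then obtain \<I> where "tight_twins r k xs \<I>"
    unfolding contains_tight_twins_def xs_def P_def by blast
  then have fin: "finite \<I>" "card \<I> = r" "disjoint \<I>"
    and twin: "\<And>I. I \<in> \<I> \<Longrightarrow> I \<subseteq> {..<length xs} \<and> card I = k"
    and sim: "\<And>I J. I \<in> \<I> \<Longrightarrow> J \<in> \<I> \<Longrightarrow> similar (nths xs I) (nths xs J)"
    and "\<exists>a. \<Union>\<I> = {a..<a + r * k}"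
    unfolding tight_twins_def by blast+
  then obtain a where U: "\<Union>\<I> = {a..<a + r * k}" by blast
  interpret layered_twins r k a P \<I>
    by unfold_locales (use assms fin twin U P_def in auto)
  define e where "e I i = sorted_list_of_set I ! i" for I :: "nat set" and i
  have len: "length (sorted_list_of_set I) = k" if "I \<in> \<I>" for I
    using twin[OF that] by simp
  show False
  proof (rule not_same_layer_pattern[of e])
    show "e I ` {..<k} = I" if I: "I \<in> \<I>" for I
    proof -
      have "e I ` {..<k} = set (sorted_list_of_set I)"
        using len[OF I] by (auto simp: e_def in_set_conv_nth)
      then show ?thesis using finite_twin[OF I] by simp
    qed
    show mono: "e I i < e I j" if "I \<in> \<I>" "i < j" "j < k" for I i j
      using sorted_wrt_nth_less[OF strict_sorted_list_of_set[of I], of i j] that len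
      by (simp add: e_def)
    have val: "nths xs I ! i = layered_value P (e I i)" "length (nths xs I) = k"
      if I: "I \<in> \<I>" and i: "i < k" for I i
    proof -
      have "sorted_list_of_set I ! i \<in> I"
        using len[OF I] i finite_twin[OF I] nth_mem[of i "sorted_list_of_set I"] by simp
      then have "sorted_list_of_set I ! i < n" using twin[OF I] by (auto simp: xs_def)
      then show "nths xs I ! i = layered_value P (e I i)" "length (nths xs I) = k"
        using nths_conv_sorted_list_of_set[of I xs] twin[OF I] len[OF I] i
        by (auto simp: e_def xs_def)
    qed
    have key: "nths xs I ! i < nths xs I ! j \<longleftrightarrow> layer P (e I i) = layer P (e I j)"
      if "I \<in> \<I>" "i < j" "j < k" for I i j
      using layered_value_less[OF mono[OF that] P_pos] val(1)[OF that(1)] that by fastforce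
    show "layer P (e I i) = layer P (e I j) \<longleftrightarrow> layer P (e J i) = layer P (e J j)"
      if "I \<in> \<I>" "J \<in> \<I>" "i < j" "j < k" for I J i j
      using sim[OF that(1,2)] key[OF that(1,3,4)] key[OF that(2,3,4)] val(2)[OF that(1,4)] that
      unfolding similar_def by auto
  qed
qed

theorem proposition4p4:
  fixes r k :: nat
  assumes "r \<ge> 3" and "k \<ge> 3"
  shows "f_tight r k = \<infinity>"
proof -
  define P where "P = r * (k - 1)"
  have "P > 0" using assms by (simp add: P_def)
  have "\<not> (\<forall>xs :: int list. distinct xs \<and> length xs = n \<longrightarrow> contains_tight_twins r k xs)" for n
  proof -
    have "distinct (map (layered_value P) [0..<n])"
      using inj_layered_value[OF \<open>P > 0\<close>] by (auto simp: distinct_map intro: inj_on_subset)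
    moreover have "length (map (layered_value P) [0..<n]) = n" by simp
    moreover have "\<not> contains_tight_twins r k (map (layered_value P) [0..<n])"
      using layered_no_tight_twins[of r k n] assms by (simp add: P_def)
    ultimately show ?thesis by blast
  qed
  then have "{enat n | n. \<forall>xs :: int list. distinct xs \<and> length xs = n \<longrightarrow> contains_tight_twins r k xs} = {}"
    by blast
  then show ?thesis unfolding f_tight_def by (simp only: Inf_empty top_enat_def)
qed

end
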